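(* For every positive integer $n$, $$t(1,2,6,6;n)=2N(1,2,6,6;8n+15)-N(1,2,6,6;16n+30)$$ and $$t(2,2,3,6;n)=2N(2,2,3,6;8n+13)-N(2,2,3,6;16n+26).$$
   Context: For positive integers $a_1,\dots,a_k$ and a nonnegative integer $n$, $N(a_1,\dots,a_k;n)$ is the number of $(x_1,\dots,x_k)\in\mathbb Z^k$ with $n=a_1x_1^2+\cdots+a_kx_k^2$, and $t(a_1,\dots,a_k;n)$ is the number of $(x_1,\dots,x_k)\in\mathbb Z^k$ with $n=a_1\frac{x_1(x_1-1)}2+\cdots+a_k\frac{x_k(x_k-1)}2$. *)

theory Defs
  imports Complex_Main
begin

(* In both definitions the coefficients a_1, ..., a_k are the entries of the list as, and a point
   of Z^k is an integer list of length k. The counted sets are finite when all coefficients are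
   positive, which is the only case of interest. *)

definition N_repr :: "nat list \<Rightarrow> nat \<Rightarrow> nat" where
  "N_repr as n = card {xs :: int list. length xs = length as \<and>
     int n = (\<Sum>i<length as. int (as ! i) * (xs ! i)\<^sup>2)}"

(* The division by 2 is exact, since x * (x - 1) is always even. *)
definition t_repr :: "nat list \<Rightarrow> nat \<Rightarrow> nat" where
  "t_repr as n = card {xs :: int list. length xs = length as \<and>
     int n = (\<Sum>i<length as. int (as ! i) * (xs ! i * (xs ! i - 1) div 2))}"

end

theory Submission
  imports Defs
begin

text \<open>
  Write \<open>m = 8 n + 15\<close>. Completing squares, \<open>t(1,2,6,6;n)\<close> counts the representations of \<open>m\<close> by
  \<open>E = x\<^sup>2 + 2 y\<^sup>2 + 6 z\<^sup>2 + 6 w\<^sup>2\<close> with all variables odd, and \<open>N(1,2,6,6;2m)\<close> is the number of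
  representations of \<open>m\<close> by \<open>F = x\<^sup>2 + 2 y\<^sup>2 + 3 z\<^sup>2 + 3 w\<^sup>2\<close>. Those of the latter with \<open>z \<equiv> w (mod 2)\<close>
  correspond to all representations by \<open>E\<close>, so it remains to match the representations by \<open>E\<close> that
  are not all odd with those by \<open>F\<close> having \<open>z \<not>\<equiv> w (mod 2)\<close>. Modulo 8, up to exchanging \<open>z\<close> and \<open>w\<close>,
  both are parametrised by solutions of \<open>3 p\<^sup>2 + q\<^sup>2 + 3 r\<^sup>2 + 8 s\<^sup>2 = m\<close> with \<open>p, q, r\<close> odd: the former by
  those with \<open>p \<equiv> r (mod 4)\<close>, through \<open>p, r = z \<plusminus> w\<close>, the latter by those with \<open>p \<equiv> q (mod 4)\<close>,
  through \<open>q\<^sup>2 + 3 p\<^sup>2 = x\<^sup>2 + 3 w\<^sup>2\<close> with \<open>q = (x + 3 w)/2\<close>, \<open>p = (x - w)/2\<close>. Each congruence selects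
  exactly one sign of \<open>p\<close>, so the two families are equinumerous. The second identity is proved in the
  same way with \<open>p\<^sup>2 + 3 q\<^sup>2 + r\<^sup>2 + 24 s\<^sup>2 = 8 n + 13\<close>.
\<close>

section \<open>Representations by diagonal quaternary forms\<close>

definition quad_reps :: "int \<Rightarrow> int \<Rightarrow> int \<Rightarrow> int \<Rightarrow> int \<Rightarrow> (int \<times> int \<times> int \<times> int) set" where
  "quad_reps a b c d m = {(x, y, z, w). a * x\<^sup>2 + b * y\<^sup>2 + c * z\<^sup>2 + d * w\<^sup>2 = m}"

lemma mem_quad_reps [simp]:
  "(x, y, z, w) \<in> quad_reps a b c d m \<longleftrightarrow> a * x\<^sup>2 + b * y\<^sup>2 + c * z\<^sup>2 + d * w\<^sup>2 = m"
  by (simp add: quad_reps_def)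

text \<open>No term exceeds \<open>m\<close>, as the others are nonnegative, and \<bar>x\<bar> is at
  most \<open>x\<^sup>2\<close> for an integer \<open>x\<close>; so all solutions lie in a
  box.\<close>

lemma finite_quad_reps:
  assumes "a > 0" "b > 0" "c > 0" "d > 0"
  shows "finite (quad_reps a b c d m)"
proof -
  have bound: "\<bar>x\<bar> \<le> m" if "k > 0" "k * x\<^sup>2 + e = m" "e \<ge> 0" for k x e :: int
  proof -
    have "\<bar>x\<bar> \<le> \<bar>x\<bar> * \<bar>x\<bar>" using mult_right_mono[of 1 "\<bar>x\<bar>" "\<bar>x\<bar>"] by (cases "x = 0") auto
    also have "\<dots> = 1 * x\<^sup>2" by (simp add: power2_eq_square)
    also have "\<dots> \<le> k * x\<^sup>2" using that by (intro mult_right_mono) auto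
    finally show ?thesis using that by linarith
  qed
  have nonneg: "a * x\<^sup>2 \<ge> 0" "b * x\<^sup>2 \<ge> 0" "c * x\<^sup>2 \<ge> 0" "d * x\<^sup>2 \<ge> 0" for x
    using assms by auto
  have "quad_reps a b c d m \<subseteq> {-m..m} \<times> {-m..m} \<times> {-m..m} \<times> {-m..m}"
  proof
    fix v assume "v \<in> quad_reps a b c d m"
    then obtain x y z w where v: "v = (x, y, z, w)"
      and eq: "a * x\<^sup>2 + b * y\<^sup>2 + c * z\<^sup>2 + d * w\<^sup>2 = m"
      by (cases v) auto
    have "\<bar>x\<bar> \<le> m"
      by (rule bound[of a x "b * y\<^sup>2 + c * z\<^sup>2 + d * w\<^sup>2"]) (use assms eq nonneg in auto)
    moreover have "\<bar>y\<bar> \<le> m"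
      by (rule bound[of b y "a * x\<^sup>2 + c * z\<^sup>2 + d * w\<^sup>2"]) (use assms eq nonneg in auto)
    moreover have "\<bar>z\<bar> \<le> m"
      by (rule bound[of c z "a * x\<^sup>2 + b * y\<^sup>2 + d * w\<^sup>2"]) (use assms eq nonneg in auto)
    moreover have "\<bar>w\<bar> \<le> m"
      by (rule bound[of d w "a * x\<^sup>2 + b * y\<^sup>2 + c * z\<^sup>2"]) (use assms eq nonneg in auto)
    ultimately show "v \<in> {-m..m} \<times> {-m..m} \<times> {-m..m} \<times> {-m..m}" by (auto simp: v)
  qed
  then show ?thesis by (rule finite_subset) auto
qed

text \<open>Every bijective count below is given by an explicit pair of mutually inverse maps;
  finiteness is not assumed.\<close>

lemma card_eq_by_inverse:
  assumes "\<And>v. v \<in> A \<Longrightarrow> f v \<in> B \<and> g (f v) = v" "\<And>v. v \<in> B \<Longrightarrow> g v \<in> A \<and> f (g v) = v"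
  shows "card A = card B"
  by (rule bij_betw_same_card[of f], rule bij_betw_byWitness[of _ g]) (use assms in auto)

lemma N_repr_four: "N_repr [a, b, c, d] n = card (quad_reps a b c d n)"
  unfolding N_repr_def
  by (rule card_eq_by_inverse[where f = "\<lambda>xs. (xs!0, xs!1, xs!2, xs!3)"
        and g = "\<lambda>(x, y, z, w). [x, y, z, w]"])
    (auto simp: quad_reps_def numeral_eq_Suc length_Suc_conv)

abbreviation all_odd :: "(int \<times> int \<times> int \<times> int) set" where
  "all_odd \<equiv> {(x, y, z, w). odd x \<and> odd y \<and> odd z \<and> odd w}"

lemma odd_square_triangular: "(2 * x - 1)\<^sup>2 = 8 * (x * (x - 1) div 2) + (1::int)"
proof -
  have "2 * (x * (x - 1) div 2) = x * (x - 1)" by (rule dvd_mult_div_cancel) simp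
  moreover have "(2 * x - 1)\<^sup>2 = 4 * (x * (x - 1)) + 1" by (simp add: power2_eq_square algebra_simps)
  ultimately show ?thesis by linarith
qed

text \<open>Multiplying the equation by 8 and adding the sum of the coefficients turns each
  triangular number into an odd square; \<open>x\<close> \<mapsto> \<open>2 * x - 1\<close> is a
  bijection from the integers to the odd integers.\<close>

lemma t_repr_four:
  "t_repr [a, b, c, d] n
     = card (quad_reps a b c d (8 * int n + int a + int b + int c + int d) \<inter> all_odd)"
proof -
  define T :: "int \<Rightarrow> int" where "T x = x * (x - 1) div 2" for x
  have T: "(2 * x - 1)\<^sup>2 = 8 * T x + 1" for x
    unfolding T_def by (rule odd_square_triangular)
  show ?thesis
    unfolding t_repr_def T_def[symmetric]
  proof (rule card_eq_by_inverse[
        where f = "\<lambda>xs. (2 * xs!0 - 1, 2 * xs!1 - 1, 2 * xs!2 - 1, 2 * xs!3 - 1)"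
        and g = "\<lambda>(x, y, z, w). [(x + 1) div 2, (y + 1) div 2, (z + 1) div 2, (w + 1) div 2]"], goal_cases)
    case (1 v)
    then obtain x y z w where v: "v = [x, y, z, w]" by (auto simp: length_Suc_conv)
    with 1 have "int n = a * T x + b * T y + c * T z + d * T w" by (simp add: numeral_eq_Suc)
    with v show ?case by (simp add: T) (simp add: algebra_simps)
  next
    case (2 v)
    then obtain x' y' z' w' where v': "v = (x', y', z', w')" "odd x'" "odd y'" "odd z'" "odd w'"
      by (cases v) auto
    have "\<exists>j. k = 2 * j - 1" if "odd k" for k :: int using that by presburger
    then obtain x y z w where "x' = 2 * x - 1" "y' = 2 * y - 1" "z' = 2 * z - 1" "w' = 2 * w - 1"
      using v' by metis
    with v' have v: "v = (2 * x - 1, 2 * y - 1, 2 * z - 1, 2 * w - 1)" by simp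
    with 2 have "int n = a * T x + b * T y + c * T z + d * T w"
      by (simp add: T) (simp add: algebra_simps)
    with v show ?case by (simp add: numeral_eq_Suc algebra_simps)
  qed
qed

section \<open>Squares modulo 8 and sign changes\<close>

lemma square_mod_8: "x\<^sup>2 mod 8 = (if odd x then 1 else if 4 dvd x then 0 else 4)" for x :: int
proof -
  have "x mod 8 \<in> {0..<8}" by simp
  then have "x mod 8 \<in> {0, 1, 2, 3, 4, 5, 6, 7}" by auto
  moreover have "odd x \<longleftrightarrow> odd (x mod 8)" "4 dvd x \<longleftrightarrow> 4 dvd x mod 8" by presburger+
  moreover have "x\<^sup>2 mod 8 = (x mod 8)\<^sup>2 mod 8" by (simp add: power_mod)
  ultimately show ?thesis by auto
qed

lemma quad_form_mod_8:
  "(a * x\<^sup>2 + b * y\<^sup>2 + c * z\<^sup>2 + d * w\<^sup>2) mod 8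
     = (a * (x\<^sup>2 mod 8) + b * (y\<^sup>2 mod 8) + c * (z\<^sup>2 mod 8) + d * (w\<^sup>2 mod 8)) mod (8::int)"
  by (intro mod_add_cong mod_mult_cong mod_mod_trivial[symmetric] refl)

text \<open>For odd \<open>p\<close> and \<open>q\<close>, exactly one of \<open>p\<close> and
  \<open>- p\<close> is congruent to \<open>q\<close> modulo 4, and likewise for \<open>r\<close>.
  Both sets thus pick one point from each pair that differs in the sign of \<open>p\<close>.\<close>

lemma card_flip_sign:
  fixes S :: "(int \<times> int \<times> int \<times> 'a) set"
  assumes odd: "\<And>p q r s. (p, q, r, s) \<in> S \<Longrightarrow> odd p \<and> odd q \<and> odd r"
    and neg: "\<And>p q r s. (p, q, r, s) \<in> S \<Longrightarrow> (- p, q, r, s) \<in> S"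
  shows "card {(p, q, r, s) \<in> S. 4 dvd p - q} = card {(p, q, r, s) \<in> S. 4 dvd p - r}"
proof (rule card_eq_by_inverse[
        where f = "\<lambda>(p, q, r, s). (if 4 dvd p - r then p else - p, q, r, s)"
        and g = "\<lambda>(p, q, r, s). (if 4 dvd p - q then p else - p, q, r, s)"], goal_cases)
  case (1 v)
  then obtain p q r s where v: "v = (p, q, r, s)" "(p, q, r, s) \<in> S" "4 dvd p - q" by (cases v) auto
  with odd have "odd p" "odd q" "odd r" by blast+
  then have "4 dvd - p - r" if "\<not> 4 dvd p - r" using that by presburger
  moreover have "\<not> 4 dvd - p - q" using v \<open>odd p\<close> by presburger
  ultimately show ?case using v neg by auto
next
  case (2 v)
  then obtain p q r s where v: "v = (p, q, r, s)" "(p, q, r, s) \<in> S" "4 dvd p - r" by (cases v) auto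
  with odd have "odd p" "odd q" "odd r" by blast+
  then have "4 dvd - p - q" if "\<not> 4 dvd p - q" using that by presburger
  moreover have "\<not> 4 dvd - p - r" using v \<open>odd p\<close> by presburger
  ultimately show ?case using v neg by auto
qed

section \<open>The form (1,2,6,6)\<close>

text \<open>Here \<open>x\<close> must be even; with \<open>x = 2 * k\<close>, halving the equation
  turns \<open>x\<^sup>2\<close> into \<open>2 * k\<^sup>2\<close> and \<open>2 * y\<^sup>2\<close>
  into \<open>y\<^sup>2\<close>, so these two variables trade places.\<close>

lemma N_1266_double: "N_repr [1, 2, 6, 6] (2 * n) = card (quad_reps 1 2 3 3 n)"
  unfolding N_repr_four
proof (rule card_eq_by_inverse[
        where f = "\<lambda>(x, y, z, w). (y, x div 2, z, w)"
        and g = "\<lambda>(x, y, z, w). (2 * y, x, z, w)"], goal_cases)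
  case (1 v)
  then obtain x y z w where v: "v = (x, y, z, w)" "x\<^sup>2 + 2 * y\<^sup>2 + 6 * z\<^sup>2 + 6 * w\<^sup>2 = 2 * int n"
    by (cases v) auto
  then have "x\<^sup>2 = 2 * (int n - y\<^sup>2 - 3 * z\<^sup>2 - 3 * w\<^sup>2)" by simp
  then have "even (x\<^sup>2)" by (rule dvdI)
  then obtain k where "x = 2 * k" by auto
  with v show ?case by (simp add: power2_eq_square)
qed (auto simp: power2_eq_square)

text \<open>This rests on \<open>3 * (z + w)\<^sup>2 + 3 * (z - w)\<^sup>2 = 6 * z\<^sup>2 + 6 *
  w\<^sup>2\<close>.\<close>

lemma card_1233_same_parity:
  "card {(x, y, z, w) \<in> quad_reps 1 2 3 3 m. even (z + w)} = card (quad_reps 1 2 6 6 m)"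
proof (rule card_eq_by_inverse[
        where f = "\<lambda>(x, y, z, w). (x, y, (z + w) div 2, (z - w) div 2)"
        and g = "\<lambda>(x, y, z, w). (x, y, z + w, z - w)"], goal_cases)
  case (1 v)
  then obtain x y z w where v: "v = (x, y, z, w)" "even (z + w)" by (cases v) auto
  then obtain k where k: "z + w = 2 * k" by blast
  then have "z = 2 * k - w" by simp
  with v(1) 1 show ?case by (auto simp: power2_eq_square algebra_simps)
qed (auto simp: power2_eq_square algebra_simps)

text \<open>Since \<open>m\<close> is odd, so is \<open>x\<close>; what remains is
  \<open>y\<^sup>2 + 3 * z\<^sup>2 + 3 * w\<^sup>2\<close> \<equiv> 3 modulo 4, where squares are 0
  or 1.\<close>

lemma parity_1266:
  assumes "m mod 8 = 7" "x\<^sup>2 + 2 * y\<^sup>2 + 6 * z\<^sup>2 + 6 * w\<^sup>2 = (m::int)"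
  shows "odd x \<and> (odd y \<and> odd z \<and> odd w \<or> even y \<and> (odd z \<longleftrightarrow> even w))"
  using quad_form_mod_8[of 1 x 2 y 6 z 6 w] assms
  unfolding square_mod_8 by (auto split: if_splits)

text \<open>Modulo 8 the equation leaves \<open>x\<^sup>2 + 2 * y\<^sup>2 + 3 * w\<^sup>2\<close>
  \<equiv> 4, which forces \<open>x\<close>, then \<open>y\<close>, to be even, and then
  \<open>x\<^sup>2 + 3 * w\<^sup>2\<close> \<equiv> 4.\<close>

lemma parity_1233:
  assumes "m mod 8 = 7" "x\<^sup>2 + 2 * y\<^sup>2 + 3 * z\<^sup>2 + 3 * w\<^sup>2 = (m::int)" "odd z" "even w"
  shows "even x \<and> even y \<and> (4 dvd x \<longleftrightarrow> \<not> 4 dvd w)"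
  using quad_form_mod_8[of 1 x 2 y 3 z 3 w] assms
  unfolding square_mod_8 by (auto split: if_splits)

lemma card_1266_not_odd:
  assumes m: "m mod 8 = 7"
  shows "card (quad_reps 1 2 6 6 m - all_odd)
           = card {(x, y, z, w) \<in> quad_reps 1 2 3 3 m. odd (z + w)}"
proof -
  define E where "E = {(x, y, z, w) \<in> quad_reps 1 2 6 6 m. even y \<and> odd z \<and> even w}"
  define E' where "E' = {(x, y, z, w) \<in> quad_reps 1 2 6 6 m. even y \<and> even z \<and> odd w}"
  define F where "F = {(x, y, z, w) \<in> quad_reps 1 2 3 3 m. odd z \<and> even w}"
  define F' where "F' = {(x, y, z, w) \<in> quad_reps 1 2 3 3 m. even z \<and> odd w}"
  define S where "S = {(p, q, r, s) \<in> quad_reps 3 1 3 8 m. odd p \<and> odd q \<and> odd r}"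
  have fin: "finite E" "finite E'" "finite F" "finite F'"
    unfolding E_def E'_def F_def F'_def
    by (rule finite_subset[OF _ finite_quad_reps[of 1 2 6 6 m]]
             finite_subset[OF _ finite_quad_reps[of 1 2 3 3 m]]; force)+
  have par: "odd x \<and> (odd y \<and> odd z \<and> odd w \<or> even y \<and> (odd z \<longleftrightarrow> even w))"
    if "(x, y, z, w) \<in> quad_reps 1 2 6 6 m" for x y z w
    using that parity_1266[OF m] by simp
  have "quad_reps 1 2 6 6 m - all_odd = E \<union> E'"
    unfolding E_def E'_def using par by (auto simp del: mem_quad_reps)
  moreover have "E \<inter> E' = {}" by (auto simp: E_def E'_def)
  moreover have "card E = card E'"
    by (rule card_eq_by_inverse[where f = "\<lambda>(x, y, z, w). (x, y, w, z)"
          and g = "\<lambda>(x, y, z, w). (x, y, w, z)"]) (auto simp: E_def E'_def)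
  ultimately have 1: "card (quad_reps 1 2 6 6 m - all_odd) = 2 * card E"
    using fin by (simp add: card_Un_disjoint)
  have "{(x, y, z, w) \<in> quad_reps 1 2 3 3 m. odd (z + w)} = F \<union> F'"
    unfolding F_def F'_def by auto
  moreover have "F \<inter> F' = {}" by (auto simp: F_def F'_def)
  moreover have "card F = card F'"
    by (rule card_eq_by_inverse[where f = "\<lambda>(x, y, z, w). (x, y, w, z)"
          and g = "\<lambda>(x, y, z, w). (x, y, w, z)"]) (auto simp: F_def F'_def)
  ultimately have 2: "card {(x, y, z, w) \<in> quad_reps 1 2 3 3 m. odd (z + w)} = 2 * card F"
    using fin by (simp add: card_Un_disjoint)
  \<comment> \<open>The identity \<open>6 * z\<^sup>2 + 6 * w\<^sup>2 = 3 * (z + w)\<^sup>2 + 3 * (z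
    - w)\<^sup>2\<close> is used again; \<open>p - r = 2 * w\<close>, so the congruence expresses
    that \<open>w\<close> is even.\<close>
  have 3: "card E = card {(p, q, r, s) \<in> S. 4 dvd p - r}"
  proof (rule card_eq_by_inverse[
        where f = "\<lambda>(x, y, z, w). (z + w, x, z - w, y div 2)"
        and g = "\<lambda>(p, q, r, s). (q, 2 * s, (p + r) div 2, (p - r) div 2)"], goal_cases)
    case (1 v)
    then obtain x y z w where v: "v = (x, y, z, w)" by (cases v) auto
    with 1 have eq: "x\<^sup>2 + 2 * y\<^sup>2 + 6 * z\<^sup>2 + 6 * w\<^sup>2 = m" and par: "even y" "odd z" "even w"
      by (auto simp: E_def)
    from par obtain s k where "y = 2 * s" "w = 2 * k" by (auto elim!: evenE)
    with v eq par parity_1266[OF m eq] show ?case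
      by (auto simp: S_def power2_eq_square algebra_simps)
  next
    case (2 v)
    then obtain p q r s where v: "v = (p, q, r, s)" by (cases v) auto
    with 2 have eq: "3 * p\<^sup>2 + q\<^sup>2 + 3 * r\<^sup>2 + 8 * s\<^sup>2 = m" and par: "odd p" "odd q" "odd r" "4 dvd p - r"
      by (auto simp: S_def)
    from par obtain k where "p - r = 4 * k" by auto
    then have p: "p = r + 4 * k" by simp
    have "(p + r) div 2 = r + 2 * k" "(p - r) div 2 = 2 * k" by (auto simp: p)
    with v eq par p show ?case
      by (auto simp: E_def power2_eq_square algebra_simps)
  qed
  \<comment> \<open>Now \<open>p - q = - 2 * w\<close>, so evenness of \<open>w\<close> becomes the
    congruence between \<open>p\<close> and \<open>q\<close>.\<close>
  have 4: "card F = card {(p, q, r, s) \<in> S. 4 dvd p - q}"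
  proof (rule card_eq_by_inverse[
        where f = "\<lambda>(x, y, z, w). ((x - w) div 2, (x + 3 * w) div 2, z, y div 2)"
        and g = "\<lambda>(p, q, r, s). ((q + 3 * p) div 2, 2 * s, r, (q - p) div 2)"], goal_cases)
    case (1 v)
    then obtain x y z w where v: "v = (x, y, z, w)" by (cases v) auto
    with 1 have eq: "x\<^sup>2 + 2 * y\<^sup>2 + 3 * z\<^sup>2 + 3 * w\<^sup>2 = m" and par: "odd z" "even w"
      by (auto simp: F_def)
    note par' = parity_1233[OF m eq par]
    from par par' obtain X s W where k: "x = 2 * X" "y = 2 * s" "w = 2 * W" by (auto elim!: evenE)
    \<comment> \<open>Exactly one of \<open>x\<close> and \<open>w\<close> is divisible by 4, so
      \<open>X\<close> and \<open>W\<close> have opposite parity; this makes \<open>p\<close> and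
      \<open>q\<close> odd.\<close>
    then have "odd (X + W)" using par' by presburger
    moreover have "(x - w) div 2 = X - W" "(x + 3 * w) div 2 = X + 3 * W" by (auto simp: k)
    ultimately show ?case using v eq par k
      by (auto simp: S_def power2_eq_square algebra_simps)
  next
    case (2 v)
    then obtain p q r s where v: "v = (p, q, r, s)" by (cases v) auto
    with 2 have eq: "3 * p\<^sup>2 + q\<^sup>2 + 3 * r\<^sup>2 + 8 * s\<^sup>2 = m" and par: "odd p" "odd q" "odd r" "4 dvd p - q"
      by (auto simp: S_def)
    from par obtain k where "p - q = 4 * k" by auto
    then have q: "q = p - 4 * k" by simp
    have "(q + 3 * p) div 2 = 2 * p - 2 * k" "(q - p) div 2 = - 2 * k" by (auto simp: q)
    with v eq par q show ?case
      by (auto simp: F_def power2_eq_square algebra_simps)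
  qed
  have "card {(p, q, r, s) \<in> S. 4 dvd p - q} = card {(p, q, r, s) \<in> S. 4 dvd p - r}"
    by (rule card_flip_sign) (auto simp: S_def)
  with 1 2 3 4 show ?thesis by simp
qed

section \<open>The form (2,2,3,6)\<close>

lemma N_2236_double: "N_repr [2, 2, 3, 6] (2 * n) = card (quad_reps 1 1 3 6 n)"
  unfolding N_repr_four
proof (rule card_eq_by_inverse[
        where f = "\<lambda>(x, y, z, w). (x, y, w, z div 2)"
        and g = "\<lambda>(x, y, z, w). (x, y, 2 * w, z)"], goal_cases)
  case (1 v)
  then obtain x y z w where v: "v = (x, y, z, w)" "2 * x\<^sup>2 + 2 * y\<^sup>2 + 3 * z\<^sup>2 + 6 * w\<^sup>2 = 2 * int n"
    by (cases v) auto
  \<comment> \<open>Splitting \<open>3 * z\<^sup>2\<close> as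
    \<open>z\<^sup>2 + 2 * z\<^sup>2\<close> exhibits \<open>z\<^sup>2\<close> as even.\<close>
  then have "z\<^sup>2 = 2 * (int n - x\<^sup>2 - y\<^sup>2 - z\<^sup>2 - 3 * w\<^sup>2)" by simp
  then have "even (z\<^sup>2)" by (rule dvdI)
  then obtain k where "z = 2 * k" by auto
  with v show ?case by (simp add: power2_eq_square)
qed (auto simp: power2_eq_square)

lemma card_1136_same_parity:
  "card {(x, y, z, w) \<in> quad_reps 1 1 3 6 m. even (x + y)} = card (quad_reps 2 2 3 6 m)"
proof (rule card_eq_by_inverse[
        where f = "\<lambda>(x, y, z, w). ((x + y) div 2, (x - y) div 2, z, w)"
        and g = "\<lambda>(x, y, z, w). (x + y, x - y, z, w)"], goal_cases)
  case (1 v)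
  then obtain x y z w where v: "v = (x, y, z, w)" "even (x + y)" by (cases v) auto
  then obtain k where k: "x + y = 2 * k" by blast
  then have "x = 2 * k - y" by simp
  with v(1) 1 show ?case by (auto simp: power2_eq_square algebra_simps)
qed (auto simp: power2_eq_square algebra_simps)

text \<open>Here \<open>z\<close> is odd, and what remains is
  \<open>x\<^sup>2 + y\<^sup>2 + 3 * w\<^sup>2\<close> \<equiv> 1 modulo 4.\<close>

lemma parity_2236:
  assumes "m mod 8 = 5" "2 * x\<^sup>2 + 2 * y\<^sup>2 + 3 * z\<^sup>2 + 6 * w\<^sup>2 = (m::int)"
  shows "odd z \<and> (odd x \<and> odd y \<and> odd w \<or> even w \<and> (odd x \<longleftrightarrow> even y))"
  using quad_form_mod_8[of 2 x 2 y 3 z 6 w] assms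
  unfolding square_mod_8 by (auto split: if_splits)

text \<open>Modulo 8 there remains \<open>y\<^sup>2 + 3 * z\<^sup>2 + 6 * w\<^sup>2\<close> \<equiv>
  4, so \<open>z\<close>, then \<open>w\<close>, is even, and then
  \<open>y\<^sup>2 + 3 * z\<^sup>2\<close> \<equiv> 4.\<close>

lemma parity_1136:
  assumes "m mod 8 = 5" "x\<^sup>2 + y\<^sup>2 + 3 * z\<^sup>2 + 6 * w\<^sup>2 = (m::int)" "odd x" "even y"
  shows "even z \<and> even w \<and> (4 dvd y \<longleftrightarrow> \<not> 4 dvd z)"
  using quad_form_mod_8[of 1 x 1 y 3 z 6 w] assms
  unfolding square_mod_8 by (auto split: if_splits)

lemma card_2236_not_odd:
  assumes m: "m mod 8 = 5"
  shows "card (quad_reps 2 2 3 6 m - all_odd)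
           = card {(x, y, z, w) \<in> quad_reps 1 1 3 6 m. odd (x + y)}"
proof -
  define E where "E = {(x, y, z, w) \<in> quad_reps 2 2 3 6 m. odd x \<and> even y \<and> even w}"
  define E' where "E' = {(x, y, z, w) \<in> quad_reps 2 2 3 6 m. even x \<and> odd y \<and> even w}"
  define F where "F = {(x, y, z, w) \<in> quad_reps 1 1 3 6 m. odd x \<and> even y}"
  define F' where "F' = {(x, y, z, w) \<in> quad_reps 1 1 3 6 m. even x \<and> odd y}"
  define S where "S = {(p, q, r, s) \<in> quad_reps 1 3 1 24 m. odd p \<and> odd q \<and> odd r}"
  have fin: "finite E" "finite E'" "finite F" "finite F'"
    unfolding E_def E'_def F_def F'_def
    by (rule finite_subset[OF _ finite_quad_reps[of 2 2 3 6 m]]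
             finite_subset[OF _ finite_quad_reps[of 1 1 3 6 m]]; force)+
  have par: "odd z \<and> (odd x \<and> odd y \<and> odd w \<or> even w \<and> (odd x \<longleftrightarrow> even y))"
    if "(x, y, z, w) \<in> quad_reps 2 2 3 6 m" for x y z w
    using that parity_2236[OF m] by simp
  have "quad_reps 2 2 3 6 m - all_odd = E \<union> E'"
    unfolding E_def E'_def using par by (auto simp del: mem_quad_reps)
  moreover have "E \<inter> E' = {}" by (auto simp: E_def E'_def)
  moreover have "card E = card E'"
    by (rule card_eq_by_inverse[where f = "\<lambda>(x, y, z, w). (y, x, z, w)"
          and g = "\<lambda>(x, y, z, w). (y, x, z, w)"]) (auto simp: E_def E'_def)
  ultimately have 1: "card (quad_reps 2 2 3 6 m - all_odd) = 2 * card E"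
    using fin by (simp add: card_Un_disjoint)
  have "{(x, y, z, w) \<in> quad_reps 1 1 3 6 m. odd (x + y)} = F \<union> F'"
    unfolding F_def F'_def by auto
  moreover have "F \<inter> F' = {}" by (auto simp: F_def F'_def)
  moreover have "card F = card F'"
    by (rule card_eq_by_inverse[where f = "\<lambda>(x, y, z, w). (y, x, z, w)"
          and g = "\<lambda>(x, y, z, w). (y, x, z, w)"]) (auto simp: F_def F'_def)
  ultimately have 2: "card {(x, y, z, w) \<in> quad_reps 1 1 3 6 m. odd (x + y)} = 2 * card F"
    using fin by (simp add: card_Un_disjoint)
  have 3: "card E = card {(p, q, r, s) \<in> S. 4 dvd p - r}"
  proof (rule card_eq_by_inverse[
        where f = "\<lambda>(x, y, z, w). (x + y, z, x - y, w div 2)"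
        and g = "\<lambda>(p, q, r, s). ((p + r) div 2, (p - r) div 2, q, 2 * s)"], goal_cases)
    case (1 v)
    then obtain x y z w where v: "v = (x, y, z, w)" by (cases v) auto
    with 1 have eq: "2 * x\<^sup>2 + 2 * y\<^sup>2 + 3 * z\<^sup>2 + 6 * w\<^sup>2 = m" and par: "odd x" "even y" "even w"
      by (auto simp: E_def)
    from par obtain s k where "w = 2 * s" "y = 2 * k" by (auto elim!: evenE)
    with v eq par parity_2236[OF m eq] show ?case
      by (auto simp: S_def power2_eq_square algebra_simps)
  next
    case (2 v)
    then obtain p q r s where v: "v = (p, q, r, s)" by (cases v) auto
    with 2 have eq: "p\<^sup>2 + 3 * q\<^sup>2 + r\<^sup>2 + 24 * s\<^sup>2 = m" and par: "odd p" "odd q" "odd r" "4 dvd p - r"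
      by (auto simp: S_def)
    from par obtain k where "p - r = 4 * k" by auto
    then have p: "p = r + 4 * k" by simp
    have "(p + r) div 2 = r + 2 * k" "(p - r) div 2 = 2 * k" by (auto simp: p)
    with v eq par p show ?case
      by (auto simp: E_def power2_eq_square algebra_simps)
  qed
  \<comment> \<open>The substitution rests on
    \<open>y\<^sup>2 + 3 * z\<^sup>2 = p\<^sup>2 + 3 * q\<^sup>2\<close>, with
    \<open>p - q = 2 * z\<close> and \<open>z\<close> even.\<close>
  have 4: "card F = card {(p, q, r, s) \<in> S. 4 dvd p - q}"
  proof (rule card_eq_by_inverse[
        where f = "\<lambda>(x, y, z, w). ((y + 3 * z) div 2, (y - z) div 2, x, w div 2)"
        and g = "\<lambda>(p, q, r, s). (r, (p + 3 * q) div 2, (p - q) div 2, 2 * s)"], goal_cases)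
    case (1 v)
    then obtain x y z w where v: "v = (x, y, z, w)" by (cases v) auto
    with 1 have eq: "x\<^sup>2 + y\<^sup>2 + 3 * z\<^sup>2 + 6 * w\<^sup>2 = m" and par: "odd x" "even y"
      by (auto simp: F_def)
    note par' = parity_1136[OF m eq par]
    from par par' obtain Y s Z where k: "y = 2 * Y" "w = 2 * s" "z = 2 * Z" by (auto elim!: evenE)
    then have "odd (Y + Z)" using par' by presburger
    moreover have "(y + 3 * z) div 2 = Y + 3 * Z" "(y - z) div 2 = Y - Z" by (auto simp: k)
    ultimately show ?case using v eq par k
      by (auto simp: S_def power2_eq_square algebra_simps)
  next
    case (2 v)
    then obtain p q r s where v: "v = (p, q, r, s)" by (cases v) auto
    with 2 have eq: "p\<^sup>2 + 3 * q\<^sup>2 + r\<^sup>2 + 24 * s\<^sup>2 = m" and par: "odd p" "odd q" "odd r" "4 dvd p - q"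
      by (auto simp: S_def)
    from par obtain k where "p - q = 4 * k" by auto
    then have p: "p = q + 4 * k" by simp
    have "(p + 3 * q) div 2 = 2 * q + 2 * k" "(p - q) div 2 = 2 * k" by (auto simp: p)
    with v eq par p show ?case
      by (auto simp: F_def power2_eq_square algebra_simps)
  qed
  have "card {(p, q, r, s) \<in> S. 4 dvd p - q} = card {(p, q, r, s) \<in> S. 4 dvd p - r}"
    by (rule card_flip_sign) (auto simp: S_def)
  with 1 2 3 4 show ?thesis by simp
qed

section \<open>Assembly of the two identities\<close>

lemma card_split:
  assumes "finite A"
  shows "card A = card {v \<in> A. P v} + card {v \<in> A. \<not> P v}"
proof -
  have "A = {v \<in> A. P v} \<union> {v \<in> A. \<not> P v}" by auto
  then show ?thesis using assms
    by (metis (no_types, lifting) card_Un_disjoint disjoint_iff finite_Un mem_Collect_eq)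
qed

theorem theorem5p17:
  fixes n :: nat
  assumes "n > 0"
  shows "int (t_repr [1, 2, 6, 6] n) =
           2 * int (N_repr [1, 2, 6, 6] (8 * n + 15)) - int (N_repr [1, 2, 6, 6] (16 * n + 30))
       \<and> int (t_repr [2, 2, 3, 6] n) =
           2 * int (N_repr [2, 2, 3, 6] (8 * n + 13)) - int (N_repr [2, 2, 3, 6] (16 * n + 26))"
proof
  define m where "m = 8 * int n + 15"
  have m: "m mod 8 = 7" by (simp add: m_def)
  have "t_repr [1, 2, 6, 6] n = card (quad_reps 1 2 6 6 m \<inter> all_odd)"
    by (simp add: t_repr_four m_def add.commute)
  moreover have "N_repr [1, 2, 6, 6] (8 * n + 15) = card (quad_reps 1 2 6 6 m)"
    by (simp add: N_repr_four m_def)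
  moreover have "N_repr [1, 2, 6, 6] (16 * n + 30) = card (quad_reps 1 2 3 3 m)"
    using N_1266_double[of "8 * n + 15"] by (simp add: m_def)
  moreover have "card (quad_reps 1 2 6 6 m)
      = card (quad_reps 1 2 6 6 m \<inter> all_odd) + card (quad_reps 1 2 6 6 m - all_odd)"
    using card_split[OF finite_quad_reps[of 1 2 6 6 m], of "\<lambda>v. v \<in> all_odd"]
    by (simp add: Int_def set_diff_eq)
  moreover have "card (quad_reps 1 2 3 3 m)
      = card (quad_reps 1 2 6 6 m) + card (quad_reps 1 2 6 6 m - all_odd)"
    using card_split[OF finite_quad_reps[of 1 2 3 3 m], of "\<lambda>(x, y, z, w). even (z + w)"]
      card_1233_same_parity[of m] card_1266_not_odd[OF m]
    by (simp add: case_prod_unfold del: mem_quad_reps)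
  \<comment> \<open>With \<open>N\<close> and \<open>N'\<close> the counts for \<open>m\<close> and
    \<open>2 * m\<close>, and \<open>t\<close> the all-odd count, the facts combine to
    \<open>N' = N + (N - t)\<close>.\<close>
  ultimately show "int (t_repr [1, 2, 6, 6] n) =
      2 * int (N_repr [1, 2, 6, 6] (8 * n + 15)) - int (N_repr [1, 2, 6, 6] (16 * n + 30))"
    by linarith
next
  define m where "m = 8 * int n + 13"
  have m: "m mod 8 = 5" by (simp add: m_def)
  have "t_repr [2, 2, 3, 6] n = card (quad_reps 2 2 3 6 m \<inter> all_odd)"
    by (simp add: t_repr_four m_def add.commute)
  moreover have "N_repr [2, 2, 3, 6] (8 * n + 13) = card (quad_reps 2 2 3 6 m)"
    by (simp add: N_repr_four m_def)
  moreover have "N_repr [2, 2, 3, 6] (16 * n + 26) = card (quad_reps 1 1 3 6 m)"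
    using N_2236_double[of "8 * n + 13"] by (simp add: m_def)
  moreover have "card (quad_reps 2 2 3 6 m)
      = card (quad_reps 2 2 3 6 m \<inter> all_odd) + card (quad_reps 2 2 3 6 m - all_odd)"
    using card_split[OF finite_quad_reps[of 2 2 3 6 m], of "\<lambda>v. v \<in> all_odd"]
    by (simp add: Int_def set_diff_eq)
  moreover have "card (quad_reps 1 1 3 6 m)
      = card (quad_reps 2 2 3 6 m) + card (quad_reps 2 2 3 6 m - all_odd)"
    using card_split[OF finite_quad_reps[of 1 1 3 6 m], of "\<lambda>(x, y, z, w). even (x + y)"]
      card_1136_same_parity[of m] card_2236_not_odd[OF m]
    by (simp add: case_prod_unfold del: mem_quad_reps)
  ultimately show "int (t_repr [2, 2, 3, 6] n) =
      2 * int (N_repr [2, 2, 3, 6] (8 * n + 13)) - int (N_repr [2, 2, 3, 6] (16 * n + 26))"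
    by linarith
qed

end
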